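(* Let $\{\sigma_n\}_{n\in\mathbb{N}}\subset(-d,1)$ and $\{R_n\}_{n\in\mathbb{N}}\subset(0,+\infty)$. Let $U\subset\mathbb{R}^d$ be an open bounded set and let $\{E_n\}_{n\in\mathbb{N}}\subset\mathcal{M}_{\mathrm f}(\mathbb{R}^d)$ be such that $E_n\subset U$ for all $n\in\mathbb{N}$. Let $C>0$, and suppose $\hat H^{\sigma_n}_{R_n}(E_n)\le C$ for all $n\in\mathbb{N}$. Then: (a) if $\{\sigma_n\}_{n\in\mathbb{N}}\subset[0,1)$, then, up to a subsequence, $\chi_{E_n}\to\chi_E$ in $L^1(\mathbb{R}^d)$ for some $E\in\mathcal{M}_{\mathrm f}(\mathbb{R}^d)$; (b) if $\sigma_n\to0$, then, up to a subsequence, $\chi_{E_n}\to\chi_E$ in $L^1(\mathbb{R}^d)$ for some $E\in\mathcal{M}_{\mathrm f}(\mathbb{R}^d)$.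
   Context: Let $d\ge1$, let $|E|$ denote Lebesgue measure in $\mathbb{R}^d$, $\omega_d$ the measure of the unit ball, $B_\rho(x)$ the ball of radius $\rho$ and center $x$, and $\chi_E$ the characteristic function of $E$. $\mathcal{M}_{\mathrm f}(\mathbb{R}^d)$ is the family of measurable sets $E\subset\mathbb{R}^d$ with $|E|<+\infty$. For $\sigma\in(-d,1)$ and $R>0$ set $$\gamma^\sigma_R:=d\omega_d\frac{1-R^{-\sigma}}{\sigma}\ \text{ if }\sigma\ne0,\qquad \gamma^0_R:=d\omega_d\log R,$$ $$\hat H^\sigma_R(E):=\int_E\int_{B_R(x)\setminus E}\frac{1}{|x-y|^{d+\sigma}}\,dy\,dx-\gamma^\sigma_R|E|,\qquad E\in\mathcal{M}_{\mathrm f}(\mathbb{R}^d).$$ *)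

theory Defs
  imports "HOL-Analysis.Analysis"
begin

lemma measure_unit_ball_eq_unit_ball_vol:
  "measure lebesgue (ball (0 :: real ^ 'n) 1) = unit_ball_vol (real CARD('n))"
  by (simp add: content_ball)

text \<open>By the preceding lemma, \<open>unit_ball_vol (real d)\<close> is the measure of the unit ball
  of d-dimensional Euclidean space.\<close>

definition gamma_coeff :: "nat \<Rightarrow> real \<Rightarrow> real \<Rightarrow> real" where
  "gamma_coeff d \<sigma> R =
     (if \<sigma> = 0 then real d * unit_ball_vol (real d) * ln R
      else real d * unit_ball_vol (real d) * ((1 - R powr (- \<sigma>)) / \<sigma>))"

text \<open>The double integral of the nonnegative kernel may be infinite, so the functional takes
  values in the extended reals. The subtracted term is a real number,
  so no indeterminate form arises.\<close>

definition H_hat :: "real \<Rightarrow> real \<Rightarrow> (real ^ 'n) set \<Rightarrow> ereal" where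
  "H_hat \<sigma> R E =
     enn2ereal (\<integral>\<^sup>+x\<in>E. (\<integral>\<^sup>+y\<in>(ball x R - E).
         ennreal (1 / norm (x - y) powr (real CARD('n) + \<sigma>)) \<partial>lebesgue) \<partial>lebesgue)
     - ereal (gamma_coeff CARD('n) \<sigma> R * measure lebesgue E)"

end

theory Submission
  imports Defs "HOL-Complex_Analysis.Great_Picard" "HOL-Library.Diagonal_Subsequence"
begin

text \<open>Rescaling \<open>R\<close> to \<open>1\<close> turns the hypothesis into a uniform bound on the interaction of \<open>E\<^sub>n\<close> with its
  complement at distance less than 1, with kernel \<open>|x - y|\<close> to the power \<open>- d - \<sigma>\<^sub>n\<close>. If all \<open>\<sigma>\<^sub>n\<close> are
  nonnegative, or if they tend to 0, this kernel eventually dominates, up to a factor 2, any fixed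
  truncation \<open>\<phi>\<close> of \<open>|x - y|\<close> to the power \<open>- d\<close>, and by the logarithmic divergence at the origin the
  mass \<open>M\<close> of \<open>\<phi>\<close> can be made arbitrarily large. Hence the \<open>L\<^sup>1\<close> distance of the indicator function of
  \<open>E\<^sub>n\<close> from its average against \<open>\<phi> / M\<close> is of order \<open>1 / M\<close>. For fixed \<open>\<phi>\<close> the averages are
  precompact by Arzela--Ascoli, so a diagonal argument yields an \<open>L\<^sup>1\<close> Cauchy subsequence.\<close>

section \<open>Polar coordinates and the kernel on annuli\<close>

text \<open>Polar coordinates for radial functions, phrased as a pushforward. The half-lines
  \<open>{..a}\<close> are stable under intersection and generate the Borel sets, so it suffices to
  compare both measures there. On \<open>{..a}\<close> with \<open>0 \<le> a\<close> this is the
  volume of a ball, and the density is the derivative of that volume in the radius.\<close>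

lemma distr_norm_lborel:
  "distr (lborel :: 'a::euclidean_space measure) borel norm =
     density lborel (\<lambda>r. ennreal (real DIM('a) * unit_ball_vol DIM('a) * r ^ (DIM('a) - 1)) * indicator {0..} r)"
proof (rule measure_eqI_generator_eq[where E = "range (\<lambda>a::real. {..a})" and A = "\<lambda>i. {..real i}" and \<Omega> = UNIV])
  let ?c = "unit_ball_vol (real DIM('a))"
  have d: "\<And>a. emeasure (distr (lborel :: 'a measure) borel norm) {..a} = emeasure lborel (cball (0::'a) a)"
    by (subst emeasure_distr) (auto simp: cball_def intro!: arg_cong[where f = "emeasure lborel"])
  show "emeasure (distr (lborel :: 'a measure) borel norm) X =
      emeasure (density lborel (\<lambda>r. ennreal (real DIM('a) * ?c * r ^ (DIM('a) - 1)) * indicator {0..} r)) X"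
    if X: "X \<in> range (\<lambda>a::real. {..a})" for X
  proof -
    obtain a where a: "X = {..a}" using X by auto
    have "emeasure (density lborel (\<lambda>r. ennreal (real DIM('a) * ?c * r ^ (DIM('a) - 1)) * indicator {0..} r)) X
        = (\<integral>\<^sup>+r. ennreal (real DIM('a) * ?c * r ^ (DIM('a) - 1)) * indicator {0..a} r \<partial>lborel)"
      unfolding a by (subst emeasure_density) (auto intro!: nn_integral_cong simp: indicator_def)
    also have "\<dots> = emeasure lborel (cball (0::'a) a)"
    proof (cases "0 \<le> a")
      case True
      have "(\<integral>\<^sup>+r. ennreal (real DIM('a) * ?c * r ^ (DIM('a) - 1)) * indicator {0..a} r \<partial>lborel)
          = ennreal (?c * a ^ DIM('a) - ?c * 0 ^ DIM('a))"
        using True by (intro nn_integral_FTC_Icc) (auto intro!: derivative_eq_intros)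
      then show ?thesis using True by (simp add: emeasure_cball)
    qed auto
    finally show ?thesis using d a by simp
  qed
  show "sets (distr (lborel :: 'a measure) borel norm) = sigma_sets UNIV (range (\<lambda>a::real. {..a}))"
    by (simp add: borel_eq_atMost)
  show "sets (density lborel (\<lambda>r. ennreal (real DIM('a) * ?c * r ^ (DIM('a) - 1)) * indicator {0..} r))
      = sigma_sets UNIV (range (\<lambda>a::real. {..a}))"
    by (simp add: borel_eq_atMost)
  show "emeasure (distr (lborel :: 'a measure) borel norm) {..real i} \<noteq> \<infinity>" for i
    by (simp add: d emeasure_cball)
  show "(\<Union>i. {..real i}) = UNIV"
    using real_arch_simple by auto
qed (auto simp: Int_stable_def)

lemma nn_integral_radial:
  assumes [measurable]: "f \<in> borel_measurable borel"
  shows "(\<integral>\<^sup>+x. f (norm (x::'a::euclidean_space)) \<partial>lborel) =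
    (\<integral>\<^sup>+r. ennreal (real DIM('a) * unit_ball_vol DIM('a) * r ^ (DIM('a) - 1)) * indicator {0..} r * f r \<partial>lborel)"
proof -
  have "(\<integral>\<^sup>+x. f (norm (x::'a)) \<partial>lborel) = (\<integral>\<^sup>+r. f r \<partial>distr (lborel :: 'a measure) borel norm)"
    by (simp add: nn_integral_distr)
  then show ?thesis
    by (simp add: distr_norm_lborel nn_integral_density)
qed

text \<open>For negative \<sigma> the numerator decreases in the radius, but dividing by \<sigma>
  reverses the order again. Comparison with the value 0 at radius 1 gives the sign of the
  coefficient.\<close>

lemma gamma_coeff_mono:
  assumes "0 < a" "a \<le> b"
  shows "gamma_coeff d \<sigma> a \<le> gamma_coeff d \<sigma> b"
proof -
  have "(1 - a powr (- \<sigma>)) / \<sigma> \<le> (1 - b powr (- \<sigma>)) / \<sigma>" if "\<sigma> \<noteq> 0"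
    using assms that powr_mono2'[of "- \<sigma>" a b] powr_mono2[of "- \<sigma>" a b]
    by (cases "\<sigma> > 0") (auto simp: divide_right_mono divide_right_mono_neg)
  then show ?thesis
    using assms by (auto simp: gamma_coeff_def simp del: times_divide_eq_right intro!: mult_left_mono)
qed

text \<open>In polar coordinates the integrand becomes a constant multiple of
  \<open>r powr (- 1 - \<sigma>)\<close>, and \<open>gamma_coeff\<close> as a function of the radius
  is its antiderivative that vanishes at 1. The logarithm in the case \<sigma> = 0 fits this
  pattern.\<close>

lemma nn_integral_annulus:
  assumes "0 < a" "a \<le> b" "0 < real DIM('a) + \<sigma>"
  shows "(\<integral>\<^sup>+x\<in>ball 0 b - ball (0::'a::euclidean_space) a.
            ennreal (1 / norm x powr (real DIM('a) + \<sigma>)) \<partial>lborel)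
    = ennreal (gamma_coeff DIM('a) \<sigma> b - gamma_coeff DIM('a) \<sigma> a)"
proof -
  let ?d = "DIM('a)" and ?c = "unit_ball_vol (real DIM('a))"
  have "(\<integral>\<^sup>+x\<in>ball 0 b - ball (0::'a) a. ennreal (1 / norm x powr (real ?d + \<sigma>)) \<partial>lborel)
      = (\<integral>\<^sup>+x. (\<lambda>r. ennreal (1 / r powr (real ?d + \<sigma>)) * indicator {a..<b} r) (norm (x::'a)) \<partial>lborel)"
    by (intro nn_integral_cong) (auto simp: indicator_def)
  also have "\<dots> = (\<integral>\<^sup>+r. ennreal (real ?d * ?c * r ^ (?d - 1)) * indicator {0..} r *
      (ennreal (1 / r powr (real ?d + \<sigma>)) * indicator {a..<b} r) \<partial>lborel)"
    by (rule nn_integral_radial) measurable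
  also have "\<dots> = (\<integral>\<^sup>+r. ennreal (real ?d * ?c * r powr (- 1 - \<sigma>)) * indicator {a..b} r \<partial>lborel)"
  proof (rule nn_integral_cong_AE)
    \<comment> \<open>The open balls produce the half-open interval \<open>{a..<b}\<close>, whereas
      the fundamental theorem of calculus is applied on \<open>{a..b}\<close>; the two differ by a
      null set.\<close>
    have "AE r in lborel. r \<noteq> b"
      by (rule AE_lborel_singleton)
    then show "AE r in lborel. ennreal (real ?d * ?c * r ^ (?d - 1)) * indicator {0..} r *
        (ennreal (1 / r powr (real ?d + \<sigma>)) * indicator {a..<b} r)
      = ennreal (real ?d * ?c * r powr (- 1 - \<sigma>)) * indicator {a..b} r"
    proof eventually_elim
      case (elim r)
      show ?case
      proof (cases "a \<le> r \<and> r < b")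
        case True
        have "r ^ (?d - 1) * (1 / r powr (real ?d + \<sigma>)) = r powr (real (?d - 1) - (real ?d + \<sigma>))"
          using True assms by (simp add: powr_realpow[symmetric] powr_diff del: of_nat_diff)
        also have "real (?d - 1) - (real ?d + \<sigma>) = - 1 - \<sigma>"
          using DIM_positive[where 'a = 'a] by (simp add: of_nat_diff Suc_leI)
        finally have *: "real ?d * ?c * r ^ (?d - 1) * (1 / r powr (real ?d + \<sigma>)) = real ?d * ?c * r powr (- 1 - \<sigma>)"
          by (metis mult.assoc)
        show ?thesis using True assms * elim
          by (simp add: ennreal_mult'[symmetric] indicator_def)
      qed (use elim in \<open>auto simp: indicator_def\<close>)
    qed
  qed
  also have "\<dots> = ennreal (gamma_coeff ?d \<sigma> b - gamma_coeff ?d \<sigma> a)"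
  proof (rule nn_integral_FTC_Icc[where F = "gamma_coeff ?d \<sigma>"])
    show "(gamma_coeff ?d \<sigma> has_field_derivative real ?d * ?c * r powr (- 1 - \<sigma>)) (at r)"
      if "r \<in> {a..b}" for r
    proof (cases "\<sigma> = 0")
      case True
      with that assms show ?thesis
        unfolding gamma_coeff_def by (auto intro!: derivative_eq_intros simp: powr_minus field_simps)
    next
      case False
      have *: "- \<sigma> - 1 = - 1 - \<sigma>" by simp
      from False that assms show ?thesis
        unfolding gamma_coeff_def by (auto intro!: derivative_eq_intros simp: *)
    qed
  qed (use assms in auto)
  finally show ?thesis .
qed

section \<open>Passing to the energy at unit scale\<close>

text \<open>This allows each Lebesgue measurable set to be replaced by a Borel set, so that the
  double integrals can be handled over \<open>lborel\<close>, where product measurability and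
  Tonelli are available.\<close>

lemma H_hat_cong_AE:
  fixes E F :: "(real ^ 'n) set"
  assumes "AE x in lebesgue. x \<in> E \<longleftrightarrow> x \<in> F" "E \<in> sets lebesgue" "F \<in> sets lebesgue"
  shows "H_hat \<sigma> R E = H_hat \<sigma> R F"
proof -
  have "(\<integral>\<^sup>+y\<in>ball x R - E. ennreal (1 / norm (x - y) powr (real CARD('n) + \<sigma>)) \<partial>lebesgue)
      = (\<integral>\<^sup>+y\<in>ball x R - F. ennreal (1 / norm (x - y) powr (real CARD('n) + \<sigma>)) \<partial>lebesgue)" for x
    by (rule nn_integral_cong_AE) (use assms(1) in eventually_elim, auto simp: indicator_def)
  then have "(\<integral>\<^sup>+x\<in>E. (\<integral>\<^sup>+y\<in>ball x R - E. ennreal (1 / norm (x - y) powr (real CARD('n) + \<sigma>)) \<partial>lebesgue) \<partial>lebesgue)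
      = (\<integral>\<^sup>+x\<in>F. (\<integral>\<^sup>+y\<in>ball x R - F. ennreal (1 / norm (x - y) powr (real CARD('n) + \<sigma>)) \<partial>lebesgue) \<partial>lebesgue)"
    by (intro nn_integral_cong_AE) (use assms(1) in eventually_elim, auto simp: indicator_def)
  moreover have "measure lebesgue E = measure lebesgue F"
    using assms by (intro measure_eq_AE) auto
  ultimately show ?thesis
    unfolding H_hat_def by simp
qed

lemma nn_integral_annulus_at:
  fixes x :: "'a::euclidean_space"
  assumes "0 < a" "a \<le> b" "0 < real DIM('a) + \<sigma>"
  shows "(\<integral>\<^sup>+y\<in>ball x b - ball x a. ennreal (1 / norm (x - y) powr (real DIM('a) + \<sigma>)) \<partial>lborel)
    = ennreal (gamma_coeff DIM('a) \<sigma> b - gamma_coeff DIM('a) \<sigma> a)"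
proof -
  have "(\<integral>\<^sup>+y\<in>ball x b - ball x a. ennreal (1 / norm (x - y) powr (real DIM('a) + \<sigma>)) \<partial>lborel)
      = (\<integral>\<^sup>+y\<in>ball x b - ball x a. ennreal (1 / norm (x - y) powr (real DIM('a) + \<sigma>)) \<partial>distr lborel borel ((+) x))"
    by (simp add: lborel_distr_plus)
  also have "\<dots> = (\<integral>\<^sup>+y\<in>ball 0 b - ball (0::'a) a. ennreal (1 / norm y powr (real DIM('a) + \<sigma>)) \<partial>lborel)"
    by (subst nn_integral_distr) (auto intro!: nn_integral_cong simp: indicator_def dist_norm)
  finally show ?thesis
    using nn_integral_annulus[OF assms] by simp
qed

text \<open>The coefficient \<open>gamma_coeff d \<sigma> R\<close> is the integral of the kernel over \<open>B\<^sub>R - B\<^sub>1\<close> (with a minus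
  sign and the two balls exchanged if \<open>R < 1\<close>). Since the kernel is at most 1 outside \<open>B\<^sub>1\<close>, passing
  from \<open>R\<close> to \<open>1\<close> costs at most \<open>(measure lborel E)\<^sup>2\<close>.\<close>

lemma unit_scale_energy_le:
  fixes E :: "(real ^ 'n) set"
  assumes [measurable]: "E \<in> sets borel" and fin: "emeasure lborel E < \<infinity>"
    and "0 < R" and \<sigma>: "0 < real CARD('n) + \<sigma>" and H: "H_hat \<sigma> R E \<le> ereal C"
  shows "(\<integral>\<^sup>+x\<in>E. (\<integral>\<^sup>+y\<in>ball x 1 - E. ennreal (1 / norm (x - y) powr (real CARD('n) + \<sigma>)) \<partial>lborel) \<partial>lborel)
    \<le> ennreal (C + (measure lborel E)\<^sup>2)"
proof -
  define k where "k = (\<lambda>x y :: real ^ 'n. ennreal (1 / norm (x - y) powr (real CARD('n) + \<sigma>)))"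
  define I where "I = (\<lambda>\<rho>. \<integral>\<^sup>+x\<in>E. (\<integral>\<^sup>+y\<in>ball x \<rho> - E. k x y \<partial>lborel) \<partial>lborel)"
  define \<gamma> where "\<gamma> = gamma_coeff CARD('n) \<sigma> R"
  define m where "m = measure lborel E"
  have [measurable]: "(\<lambda>(x, y). k x y) \<in> borel_measurable (lborel \<Otimes>\<^sub>M lborel)"
    "k x \<in> borel_measurable borel" for x
    unfolding k_def by measurable
  \<comment> \<open>The ball moves with \<open>x\<close>, so measurability in the pair has to come
    from the inequality on the distance that defines it.\<close>
  have [measurable]: "(\<lambda>(x, y). indicator (ball x \<rho> - E) y :: ennreal) \<in> borel_measurable (lborel \<Otimes>\<^sub>M lborel)" for \<rho>
    unfolding indicator_def ball_def by measurable
  have [measurable]: "ball x a \<in> sets borel" for x :: "real ^ 'n" and a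
    by simp
  have [measurable]: "(\<lambda>y. k x y * indicator (ball x b - ball x a) y) \<in> borel_measurable borel" for x a b
    unfolding k_def by measurable
  have em: "emeasure lborel E = ennreal m"
    using fin by (simp add: m_def emeasure_eq_ennreal_measure)
  have m0: "0 \<le> m" by (simp add: m_def)
  have g1: "gamma_coeff CARD('n) \<sigma> 1 = 0"
    by (simp add: gamma_coeff_def)
  have "enn2ereal (I R) - ereal (\<gamma> * m) \<le> ereal C"
    using H unfolding H_hat_def I_def k_def \<gamma>_def m_def nn_integral_completion by simp
  \<comment> \<open>The hypothesis also forces \<open>I R\<close> to be finite: an infinite value
    would stay infinite after subtracting the real number \<open>\<gamma> * m\<close>.\<close>
  then obtain i where i: "I R = ennreal i" "0 \<le> i" "i \<le> C + \<gamma> * m"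
    by (cases "I R") (auto simp: enn2ereal_ennreal algebra_simps)
  have "I 1 \<le> ennreal (C + m\<^sup>2)"
  proof (cases "1 \<le> R")
    case True
    have \<gamma>: "(\<integral>\<^sup>+y\<in>ball x R - ball x 1. k x y \<partial>lborel) = ennreal \<gamma>" for x
      using nn_integral_annulus_at[of 1 R \<sigma> x] True \<sigma> by (simp add: k_def \<gamma>_def g1)
    have "0 \<le> \<gamma>"
      using gamma_coeff_mono[of 1 R "CARD('n)" \<sigma>] True by (simp add: \<gamma>_def g1)
    have k1: "k x y \<le> 1" if "1 \<le> norm (x - y)" for x y
      using that \<sigma> by (simp add: k_def ge_one_powr_ge_zero ennreal_le_1 divide_le_eq_1)
    have "I 1 + ennreal (\<gamma> * m) = (\<integral>\<^sup>+x\<in>E. (\<integral>\<^sup>+y\<in>ball x 1 - E. k x y \<partial>lborel) + ennreal \<gamma> \<partial>lborel)"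
      using m0 \<open>0 \<le> \<gamma>\<close> by (simp add: I_def distrib_right nn_integral_add em ennreal_mult nn_integral_cmult)
    also have "\<dots> \<le> (\<integral>\<^sup>+x\<in>E. (\<integral>\<^sup>+y\<in>ball x R - E. k x y \<partial>lborel) + ennreal m \<partial>lborel)"
    proof (intro nn_integral_mono mult_right_mono)
      fix x
      have "(\<integral>\<^sup>+y\<in>ball x 1 - E. k x y \<partial>lborel) + ennreal \<gamma>
          = (\<integral>\<^sup>+y. k x y * indicator (ball x 1 - E) y + k x y * indicator (ball x R - ball x 1) y \<partial>lborel)"
        by (subst nn_integral_add) (auto simp: \<gamma>)
      \<comment> \<open>A point \<open>y\<close> of the annulus outside \<open>E\<close> is already
        counted in \<open>ball x R - E\<close>. If it lies in \<open>E\<close>, the kernel is at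
        most 1 there and is paid for by \<open>indicator E y\<close>. This costs \<open>m\<close>
        for each \<open>x\<close>, hence \<open>m * m\<close> after integrating over
        \<open>E\<close>.\<close>
      also have "\<dots> \<le> (\<integral>\<^sup>+y. k x y * indicator (ball x R - E) y + indicator E y \<partial>lborel)"
        using True k1 by (intro nn_integral_mono) (auto simp: indicator_def dist_norm)
      also have "\<dots> = (\<integral>\<^sup>+y\<in>ball x R - E. k x y \<partial>lborel) + ennreal m"
        by (subst nn_integral_add) (auto simp: em)
      finally show "(\<integral>\<^sup>+y\<in>ball x 1 - E. k x y \<partial>lborel) + ennreal \<gamma>
        \<le> (\<integral>\<^sup>+y\<in>ball x R - E. k x y \<partial>lborel) + ennreal m" .
    qed auto
    also have "\<dots> = I R + ennreal (m * m)"
      using m0 by (simp add: I_def distrib_right nn_integral_add em ennreal_mult nn_integral_cmult)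
    also have "\<dots> = ennreal (i + m * m)"
      using i m0 by simp
    also have "\<dots> \<le> ennreal (C + m\<^sup>2 + \<gamma> * m)"
      using i by (intro ennreal_leI) (simp add: power2_eq_square)
    finally have *: "I 1 + ennreal (\<gamma> * m) \<le> ennreal (C + m\<^sup>2 + \<gamma> * m)" .
    show ?thesis
    \<comment> \<open>Cancelling \<open>\<gamma> * m\<close> in the extended nonnegative reals is
      legitimate only once \<open>I 1\<close> is known to be finite, which \<open>*\<close> itself
      guarantees.\<close>
    proof (cases "I 1")
      case (real r)
      have "0 \<le> \<gamma> * m" "0 \<le> C + m\<^sup>2 + \<gamma> * m"
        using m0 \<open>0 \<le> \<gamma>\<close> i zero_le_power2[of m] by (simp, linarith)
      then have "r \<le> C + m\<^sup>2"
        using * real by (simp add: ennreal_plus[symmetric] del: ennreal_plus)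
      then show ?thesis
        using real by (simp add: ennreal_leI)
    qed (use * in \<open>simp add: top_unique\<close>)
  next
    case False
    have \<gamma>: "(\<integral>\<^sup>+y\<in>ball x 1 - ball x R. k x y \<partial>lborel) = ennreal (- \<gamma>)" for x
      using nn_integral_annulus_at[of R 1 \<sigma> x] False \<open>0 < R\<close> \<sigma> by (simp add: k_def \<gamma>_def g1)
    have "\<gamma> \<le> 0"
      using gamma_coeff_mono[of R 1 "CARD('n)" \<sigma>] False \<open>0 < R\<close> by (simp add: \<gamma>_def g1)
    have "I 1 \<le> (\<integral>\<^sup>+x\<in>E. (\<integral>\<^sup>+y\<in>ball x R - E. k x y \<partial>lborel) + ennreal (- \<gamma>) \<partial>lborel)"
      unfolding I_def
    proof (intro nn_integral_mono mult_right_mono)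
      fix x
      \<comment> \<open>Now \<open>R < 1\<close>, and the unit ball minus \<open>E\<close> is
        covered by \<open>ball x R - E\<close> and the whole annulus, whose kernel mass is
        \<open>- \<gamma>\<close>. After integration over \<open>E\<close> this cancels the
        \<open>\<gamma> * m\<close> in the bound for \<open>i\<close>.\<close>
      have "(\<integral>\<^sup>+y\<in>ball x 1 - E. k x y \<partial>lborel)
        \<le> (\<integral>\<^sup>+y. k x y * indicator (ball x R - E) y + k x y * indicator (ball x 1 - ball x R) y \<partial>lborel)"
        by (intro nn_integral_mono) (auto simp: indicator_def)
      then show "(\<integral>\<^sup>+y\<in>ball x 1 - E. k x y \<partial>lborel)
        \<le> (\<integral>\<^sup>+y\<in>ball x R - E. k x y \<partial>lborel) + ennreal (- \<gamma>)"
        by (subst (asm) nn_integral_add) (auto simp: \<gamma>)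
    qed auto
    also have "\<dots> = I R + ennreal (- \<gamma>) * ennreal m"
      by (simp add: I_def distrib_right nn_integral_add em nn_integral_cmult)
    also have "\<dots> = ennreal (i - \<gamma> * m)"
      using i m0 \<open>\<gamma> \<le> 0\<close> ennreal_mult[of "- \<gamma>" m] ennreal_plus[of i "- \<gamma> * m"] by (simp add: mult_nonpos_nonneg)
    also have "\<dots> \<le> ennreal (C + m\<^sup>2)"
      using i by (intro ennreal_leI) (simp add: add_increasing2)
    finally show ?thesis .
  qed
  then show ?thesis
    by (simp add: I_def k_def m_def)
qed

section \<open>Limits of indicator functions\<close>

text \<open>An L1 Cauchy sequence has a subsequence that is Cauchy almost everywhere. Since {0, 1}
  is closed, the pointwise limit is again an indicator function, and domination by the indicator of
  \<open>U\<close> turns pointwise convergence into convergence in L1.\<close>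

lemma Cauchy_imp_convergent_indicator_subseq:
  fixes A :: "nat \<Rightarrow> 'a set"
  assumes A[measurable]: "\<And>n. A n \<in> sets M" and AU: "\<And>n. A n \<subseteq> U" and U: "U \<in> fmeasurable M"
    and Cauchy: "\<And>e. e > 0 \<Longrightarrow> \<exists>N. \<forall>i\<ge>N. \<forall>j\<ge>N. (LINT x|M. \<bar>indicat_real (A i) x - indicat_real (A j) x\<bar>) < e"
  obtains F and r :: "nat \<Rightarrow> nat" where "F \<in> sets M" "F \<subseteq> U" "strict_mono r"
    "(\<lambda>k. LINT x|M. \<bar>indicat_real (A (r k)) x - indicat_real F x\<bar>) \<longlonglongrightarrow> 0"
proof -
  have [measurable]: "U \<in> sets M" using U by auto
  have int: "integrable M (indicat_real (A n))" for n
    using fmeasurableI2[OF U AU A] by (simp add: fmeasurable_def integrable_indicator_iff)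
  obtain r where r: "strict_mono r" and AE: "AE x in M. Cauchy (\<lambda>i. indicat_real (A (r i)) x)"
    by (rule cauchy_L1_AE_cauchy_subseq[of M "\<lambda>n. indicat_real (A n)"]) (use int Cauchy in auto)
  \<comment> \<open>Collecting the points where the limit is 1, instead of taking some
    representative of the limit function, yields a measurable set that lies in \<open>U\<close> at
    every point and not merely almost everywhere.\<close>
  define F where "F = {x \<in> space M. (\<lambda>i. indicat_real (A (r i)) x) \<longlonglongrightarrow> 1}"
  have [measurable]: "F \<in> sets M"
    unfolding F_def by measurable
  have "F \<subseteq> U"
  proof
    fix x assume "x \<in> F"
    show "x \<in> U"
    proof (rule ccontr)
      assume "x \<notin> U"
      then have "indicat_real (A (r i)) x = 0" for i
        using AU by (auto simp: indicator_def)
      with \<open>x \<in> F\<close> show False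
        by (simp add: F_def LIMSEQ_const_iff)
    qed
  qed
  have lim: "AE x in M. (\<lambda>i. \<bar>indicat_real (A (r i)) x - indicat_real F x\<bar>) \<longlonglongrightarrow> 0"
    using AE AE_space
  proof eventually_elim
    case (elim x)
    then obtain l where l: "(\<lambda>i. indicat_real (A (r i)) x) \<longlonglongrightarrow> l"
      by (auto simp: Cauchy_convergent_iff convergent_def)
    have "closed {0, 1::real}"
      by (simp add: finite_imp_closed)
    moreover have "indicat_real (A (r i)) x \<in> {0, 1}" for i
      by (simp add: indicator_def)
    ultimately have "l \<in> {0, 1}"
      using l by (rule closed_sequentially)
    moreover have "x \<in> F \<longleftrightarrow> l = 1"
      using elim(2) l by (simp only: F_def mem_Collect_eq) (metis LIMSEQ_unique)
    ultimately have "l = indicat_real F x"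
      by (auto simp: indicator_def)
    with tendsto_rabs_zero[OF LIM_zero[OF l]] show ?case
      by simp
  qed
  have "(\<lambda>k. LINT x|M. \<bar>indicat_real (A (r k)) x - indicat_real F x\<bar>) \<longlonglongrightarrow> (LINT x|M. 0)"
  proof (rule integral_dominated_convergence[where w = "indicat_real U"])
    show "integrable M (indicat_real U)"
      using U by (simp add: fmeasurable_def integrable_indicator_iff)
    show "AE x in M. norm \<bar>indicat_real (A (r k)) x - indicat_real F x\<bar> \<le> indicat_real U x" for k
      using AU \<open>F \<subseteq> U\<close> by (intro AE_I2) (auto simp: indicator_def)
  qed (use lim in auto)
  then show ?thesis
    using that[OF \<open>F \<in> sets M\<close> \<open>F \<subseteq> U\<close> r] by simp
qed

section \<open>Averages of indicator functions against an even kernel\<close>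

lemma integrable_continuous_unit_support:
  fixes \<phi> :: "'a::euclidean_space \<Rightarrow> real"
  assumes cont: "continuous_on UNIV \<phi>" and supp: "\<And>x. 1 \<le> norm x \<Longrightarrow> \<phi> x = 0"
  shows "integrable lborel \<phi>"
proof -
  have "integrable lborel (\<lambda>x. indicator (cball 0 1) x *\<^sub>R \<phi> x)"
    by (rule borel_integrable_compact) (auto intro: continuous_on_subset[OF cont])
  also have "(\<lambda>x. indicator (cball 0 1) x *\<^sub>R \<phi> x) = \<phi>"
    using supp by (auto simp: indicator_def fun_eq_iff)
  finally show ?thesis .
qed

lemma
  fixes \<phi> :: "'a::euclidean_space \<Rightarrow> real"
  assumes \<phi>: "integrable lborel \<phi>" and sym: "\<And>x. \<phi> (- x) = \<phi> x"
  shows integrable_even_translate: "integrable lborel (\<lambda>y. \<phi> (x - y))"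
    and integral_even_translate: "(LINT y|lborel. \<phi> (x - y)) = (LINT y|lborel. \<phi> y)"
proof -
  have [measurable]: "\<phi> \<in> borel_measurable borel"
    using \<phi> by (simp add: borel_measurable_integrable)
  have \<phi>': "\<phi> (x - y) = \<phi> (- x + y)" for y
    using sym[of "x - y"] by simp
  have "integrable (distr lborel borel ((+) (- x))) \<phi>"
    using \<phi> by (simp only: lborel_distr_plus)
  then show "integrable lborel (\<lambda>y. \<phi> (x - y))"
    unfolding \<phi>' by (subst (asm) integrable_distr_eq) auto
  have "(LINT y|lborel. \<phi> y) = (LINT y|distr lborel borel ((+) (- x)). \<phi> y)"
    by (simp only: lborel_distr_plus)
  also have "\<dots> = (LINT y|lborel. \<phi> (x - y))"
    unfolding \<phi>' by (subst integral_distr) auto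
  finally show "(LINT y|lborel. \<phi> (x - y)) = (LINT y|lborel. \<phi> y)" ..
qed

text \<open>The difference at \<open>x\<close> is the integral over \<open>y\<close> of \<phi>(x -
  y) times the difference of the indicator values at \<open>x\<close> and \<open>y\<close>. Only
  pairs with exactly one point in \<open>E\<close> contribute. By Tonelli and the evenness of \<phi>
  the two kinds of pairs contribute equally, which explains the factor 2.\<close>

lemma L1_distance_mollified_indicator_le:
  fixes \<phi> :: "'a::euclidean_space \<Rightarrow> real"
  assumes \<phi>: "integrable lborel \<phi>" "\<And>x. 0 \<le> \<phi> x" and sym: "\<And>x. \<phi> (- x) = \<phi> x"
    and [measurable]: "E \<in> sets borel"
    and K: "(\<integral>\<^sup>+x\<in>E. (\<integral>\<^sup>+y\<in>- E. ennreal (\<phi> (x - y)) \<partial>lborel) \<partial>lborel) \<le> ennreal K"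
  shows "(\<integral>\<^sup>+x. ennreal \<bar>(LINT y|lborel. \<phi> y) * indicat_real E x - (LINT y|lborel. \<phi> (x - y) * indicat_real E y)\<bar> \<partial>lborel)
      \<le> 2 * ennreal K"
proof -
  have [measurable]: "\<phi> \<in> borel_measurable borel"
    using \<phi>(1) by (simp add: borel_measurable_integrable)
  note shift = integrable_even_translate[OF \<phi>(1) sym] integral_even_translate[OF \<phi>(1) sym]
  have point: "ennreal \<bar>(LINT y|lborel. \<phi> y) * indicat_real E x - (LINT y|lborel. \<phi> (x - y) * indicat_real E y)\<bar>
      \<le> (\<integral>\<^sup>+y. ennreal (\<phi> (x - y)) * indicator (- E) y * indicator E x
          + ennreal (\<phi> (x - y)) * indicator E y * indicator (- E) x \<partial>lborel)" for x
  proof -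
    have i: "integrable lborel (\<lambda>y. \<phi> (x - y) * indicat_real E y)"
      using shift(1)[of x] by (intro integrable_real_mult_indicator) auto
    have "(LINT y|lborel. \<phi> y) * indicat_real E x - (LINT y|lborel. \<phi> (x - y) * indicat_real E y)
        = (LINT y|lborel. \<phi> (x - y) * indicat_real E x - \<phi> (x - y) * indicat_real E y)"
      using shift[of x] i by (subst Bochner_Integration.integral_diff) auto
    also have "ennreal \<bar>\<dots>\<bar> \<le> (\<integral>\<^sup>+y. norm (\<phi> (x - y) * indicat_real E x - \<phi> (x - y) * indicat_real E y) \<partial>lborel)"
      using shift(1)[of x] i
      by (subst real_norm_def[symmetric], intro integral_norm_bound_ennreal Bochner_Integration.integrable_diff) auto
    also have "\<dots> = (\<integral>\<^sup>+y. ennreal (\<phi> (x - y)) * indicator (- E) y * indicator E x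
          + ennreal (\<phi> (x - y)) * indicator E y * indicator (- E) x \<partial>lborel)"
      using \<phi>(2) by (intro nn_integral_cong) (auto simp: indicator_def)
    finally show ?thesis .
  qed
  have "(\<integral>\<^sup>+x. ennreal \<bar>(LINT y|lborel. \<phi> y) * indicat_real E x - (LINT y|lborel. \<phi> (x - y) * indicat_real E y)\<bar> \<partial>lborel)
      \<le> (\<integral>\<^sup>+x. (\<integral>\<^sup>+y. ennreal (\<phi> (x - y)) * indicator (- E) y * indicator E x
          + ennreal (\<phi> (x - y)) * indicator E y * indicator (- E) x \<partial>lborel) \<partial>lborel)"
    by (intro nn_integral_mono point)
  also have "\<dots> = (\<integral>\<^sup>+x. (\<integral>\<^sup>+y. ennreal (\<phi> (x - y)) * indicator (- E) y * indicator E x \<partial>lborel) \<partial>lborel)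
      + (\<integral>\<^sup>+x. (\<integral>\<^sup>+y. ennreal (\<phi> (x - y)) * indicator E y * indicator (- E) x \<partial>lborel) \<partial>lborel)"
    by (simp add: nn_integral_add)
  also have "(\<integral>\<^sup>+x. (\<integral>\<^sup>+y. ennreal (\<phi> (x - y)) * indicator E y * indicator (- E) x \<partial>lborel) \<partial>lborel)
      = (\<integral>\<^sup>+y. (\<integral>\<^sup>+x. ennreal (\<phi> (x - y)) * indicator E y * indicator (- E) x \<partial>lborel) \<partial>lborel)"
    by (rule lborel_pair.Fubini') measurable
  also have "\<dots> = (\<integral>\<^sup>+x. (\<integral>\<^sup>+y. ennreal (\<phi> (x - y)) * indicator (- E) y * indicator E x \<partial>lborel) \<partial>lborel)"
    by (intro nn_integral_cong) (subst sym[symmetric], simp add: mult_ac)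
  also have "(\<integral>\<^sup>+x. (\<integral>\<^sup>+y. ennreal (\<phi> (x - y)) * indicator (- E) y * indicator E x \<partial>lborel) \<partial>lborel)
      = (\<integral>\<^sup>+x\<in>E. (\<integral>\<^sup>+y\<in>- E. ennreal (\<phi> (x - y)) \<partial>lborel) \<partial>lborel)"
    by (simp add: nn_integral_multc)
  also have "\<dots> + \<dots> \<le> 2 * ennreal K"
    using add_mono[OF K K] by (simp add: mult_2)
  finally show ?thesis .
qed

text \<open>The averages are bounded by the mass of \<phi>, and their modulus of continuity depends
  only on \<phi> and \<open>B\<close>, so Arzela-Ascoli applies on \<open>cball 0 (B + 1)\<close>.
  Outside that ball they vanish because \<phi> is supported in the unit ball. The conclusion is a
  uniform Cauchy estimate with this support built in, ready to be integrated.\<close>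

lemma mollified_indicator_subseq:
  fixes \<phi> :: "'a::euclidean_space \<Rightarrow> real" and E :: "nat \<Rightarrow> 'a set"
  assumes cont: "continuous_on UNIV \<phi>" and nonneg: "\<And>x. 0 \<le> \<phi> x"
    and sym: "\<And>x. \<phi> (- x) = \<phi> x" and supp: "\<And>x. 1 \<le> norm x \<Longrightarrow> \<phi> x = 0"
    and E[measurable]: "\<And>n. E n \<in> sets borel" and sub: "\<And>n. E n \<subseteq> ball 0 B"
  obtains r :: "nat \<Rightarrow> nat" where "strict_mono r"
    "\<And>e. 0 < e \<Longrightarrow> \<exists>N. \<forall>i\<ge>N. \<forall>j\<ge>N. \<forall>x.
       \<bar>(LINT y|lborel. \<phi> (x - y) * indicat_real (E (r i)) y) - (LINT y|lborel. \<phi> (x - y) * indicat_real (E (r j)) y)\<bar>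
         \<le> e * indicat_real (cball 0 (B + 1)) x"
proof -
  have int: "integrable lborel \<phi>"
    by (rule integrable_continuous_unit_support[OF cont supp])
  define g where "g = (\<lambda>n x. LINT y|lborel. \<phi> (x - y) * indicat_real (E n) y)"
  define V where "V = measure lborel (ball (0::'a) B)"
  note shift = integrable_even_translate[OF int sym] integral_even_translate[OF int sym]
  have i: "integrable lborel (\<lambda>y. \<phi> (x - y) * indicat_real (E n) y)" for x n
    using shift(1)[of x] by (intro integrable_real_mult_indicator) auto
  have gM: "norm (g n x) \<le> (LINT y|lborel. \<phi> y)" for n x
  proof -
    have "g n x \<le> (LINT y|lborel. \<phi> (x - y))"
      unfolding g_def using i shift(1)[of x] nonneg by (intro integral_mono) (auto simp: indicator_def)
    moreover have "0 \<le> g n x"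
      unfolding g_def using nonneg by (intro Bochner_Integration.integral_nonneg) auto
    ultimately show ?thesis
      using shift(2) by simp
  qed
  have V: "integrable lborel (\<lambda>y. e * indicat_real (ball (0::'a) B) y)" for e
    by (intro integrable_mult_right) (use emeasure_bounded_finite[OF bounded_ball, of 0 B] in \<open>simp add: integrable_indicator_iff\<close>)
  have equi: "\<exists>d>0. \<forall>n y. y \<in> cball 0 (B + 1) \<and> norm (x - y) < d \<longrightarrow> norm (g n x - g n y) < e"
    if x: "x \<in> cball 0 (B + 1)" and e: "0 < e" for x e
  proof -
    \<comment> \<open>The set of \<open>y\<close> that matter has measure at most \<open>V\<close>,
      so an error \<open>e'\<close> in \<phi> changes the average by at most \<open>e' * V\<close>,
      which is below \<open>e\<close>. Adding 1 keeps the denominator positive.\<close>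
    define e' where "e' = e / (V + 1)"
    have V0: "0 \<le> V" by (simp add: V_def)
    have e': "0 < e'" using e V0 by (simp add: e'_def)
    \<comment> \<open>For \<open>x\<close> in \<open>cball 0 (B + 1)\<close> and
      \<open>norm y < B\<close> the difference \<open>x - y\<close> has norm below
      \<open>2 * B + 1\<close>, so uniform continuity on this compact ball suffices.\<close>
    have "uniformly_continuous_on (cball 0 (2 * B + 1)) \<phi>"
      by (intro compact_uniformly_continuous continuous_on_subset[OF cont]) auto
    then obtain d where d: "0 < d"
      "\<And>u v. u \<in> cball 0 (2 * B + 1) \<Longrightarrow> v \<in> cball 0 (2 * B + 1) \<Longrightarrow> dist v u < d \<Longrightarrow> dist (\<phi> v) (\<phi> u) < e'"
      using e' unfolding uniformly_continuous_on_def by metis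
    have "norm (g n x - g n x') < e" if x': "x' \<in> cball 0 (B + 1)" "norm (x - x') < d" for n x'
    proof -
      have *: "norm (\<phi> (x - y) * indicat_real (E n) y - \<phi> (x' - y) * indicat_real (E n) y) \<le> e' * indicat_real (ball 0 B) y" for y
      proof (cases "y \<in> E n")
        case True
        then have y: "norm y < B" using subsetD[OF sub True] by simp
        have "dist (\<phi> (x - y)) (\<phi> (x' - y)) < e'"
        proof (rule d(2))
          show "x' - y \<in> cball 0 (2 * B + 1)" "x - y \<in> cball 0 (2 * B + 1)"
            using x x' y norm_triangle_ineq4[of x' y] norm_triangle_ineq4[of x y] by auto
          show "dist (x - y) (x' - y) < d"
            using x' by (simp add: dist_norm)
        qed
        then show ?thesis
          using True y by (simp add: dist_norm indicator_def)
      qed (use e' in auto)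
      have "g n x - g n x' = (LINT y|lborel. \<phi> (x - y) * indicat_real (E n) y - \<phi> (x' - y) * indicat_real (E n) y)"
        unfolding g_def using i by (subst Bochner_Integration.integral_diff) auto
      also have "norm \<dots> \<le> (LINT y|lborel. norm (\<phi> (x - y) * indicat_real (E n) y - \<phi> (x' - y) * indicat_real (E n) y))"
        by (rule integral_norm_bound)
      also have "\<dots> \<le> (LINT y|lborel. e' * indicat_real (ball (0::'a) B) y)"
        by (intro integral_mono integrable_norm Bochner_Integration.integrable_diff i V *)
      also have "\<dots> = e' * V"
        by (simp add: V_def)
      also have "\<dots> < e"
        using e V0 by (simp add: e'_def field_simps)
      finally show ?thesis .
    qed
    then show ?thesis using d(1) by blast
  qed
  obtain h r where r: "strict_mono (r :: nat \<Rightarrow> nat)"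
    and conv: "\<And>e. 0 < e \<Longrightarrow> \<exists>N. \<forall>n x. n \<ge> N \<and> x \<in> cball 0 (B + 1) \<longrightarrow> norm (g (r n) x - h x) < e"
    by (rule Arzela_Ascoli[of "cball 0 (B + 1)" g "LINT y|lborel. \<phi> y"]) (use gM equi in auto)
  have off: "g n x = 0" if "x \<notin> cball 0 (B + 1)" for n x
  proof -
    have *: "\<phi> (x - y) * indicat_real (E n) y = 0" for y
    proof (cases "y \<in> E n")
      case True
      then have "norm y < B" using subsetD[OF sub True] by simp
      then have "1 \<le> norm (x - y)" using that norm_triangle_ineq2[of x y] by auto
      then show ?thesis by (simp add: supp)
    qed auto
    show ?thesis by (simp only: g_def * Bochner_Integration.integral_zero)
  qed
  show ?thesis
  proof (rule that[OF r])
    fix e :: real assume "0 < e"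
    then obtain N where N: "\<And>n x. n \<ge> N \<Longrightarrow> x \<in> cball 0 (B + 1) \<Longrightarrow> norm (g (r n) x - h x) < e / 2"
      using conv[of "e / 2"] by auto
    have "\<bar>g (r i) x - g (r j) x\<bar> \<le> e * indicat_real (cball 0 (B + 1)) x" if "i \<ge> N" "j \<ge> N" for i j x
    proof (cases "x \<in> cball 0 (B + 1)")
      case True
      with N[OF that(1) True] N[OF that(2) True] have "\<bar>g (r i) x - g (r j) x\<bar> \<le> e"
        unfolding real_norm_def by linarith
      with True show ?thesis by simp
    qed (simp add: off)
    then show "\<exists>N. \<forall>i\<ge>N. \<forall>j\<ge>N. \<forall>x.
       \<bar>(LINT y|lborel. \<phi> (x - y) * indicat_real (E (r i)) y) - (LINT y|lborel. \<phi> (x - y) * indicat_real (E (r j)) y)\<bar>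
         \<le> e * indicat_real (cball 0 (B + 1)) x"
      unfolding g_def by blast
  qed
qed

section \<open>Extraction of an L1 Cauchy subsequence\<close>

text \<open>Multiply the L1 distance of two indicators by the mass of \<phi> and insert the two
  averages. Each indicator is within \<open>2 * K\<close> of its average, and the averages are
  uniformly close along a subsequence. Since \<open>4 * K\<close> is strictly below \<open>e\<close>
  times the mass, there is room left for the distance of the averages.\<close>

lemma L1_totally_bounded_indicator_subseq:
  fixes \<phi> :: "'a::euclidean_space \<Rightarrow> real" and E :: "nat \<Rightarrow> 'a set"
  assumes cont: "continuous_on UNIV \<phi>" and nonneg: "\<And>x. 0 \<le> \<phi> x"
    and sym: "\<And>x. \<phi> (- x) = \<phi> x" and supp: "\<And>x. 1 \<le> norm x \<Longrightarrow> \<phi> x = 0"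
    and E[measurable]: "\<And>n. E n \<in> sets borel" and sub: "\<And>n. E n \<subseteq> ball 0 B"
    and K: "0 \<le> K" "4 * K < e * (LINT y|lborel. \<phi> y)" and e: "0 < e"
    and energy: "\<forall>\<^sub>F n in sequentially. (\<integral>\<^sup>+x\<in>E n. (\<integral>\<^sup>+y\<in>- E n. ennreal (\<phi> (x - y)) \<partial>lborel) \<partial>lborel) \<le> ennreal K"
  obtains r :: "nat \<Rightarrow> nat" and N where "strict_mono r"
    "\<And>i j. i \<ge> N \<Longrightarrow> j \<ge> N \<Longrightarrow> (LINT x|lborel. \<bar>indicat_real (E (r i)) x - indicat_real (E (r j)) x\<bar>) < e"
proof -
  define M where "M = (LINT y|lborel. \<phi> y)"
  define W where "W = measure lborel (cball (0::'a) (B + 1))"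
  define g where "g = (\<lambda>n x. LINT y|lborel. \<phi> (x - y) * indicat_real (E n) y)"
  have int: "integrable lborel \<phi>"
    by (rule integrable_continuous_unit_support[OF cont supp])
  have [measurable]: "\<phi> \<in> borel_measurable borel"
    using int by (simp add: borel_measurable_integrable)
  have [measurable]: "g n \<in> borel_measurable borel" for n
    unfolding g_def by measurable
  have [measurable]: "(\<lambda>x::'a. ennreal \<eta> * indicator (cball 0 (B + 1)) x) \<in> borel_measurable borel" for \<eta>
    by (intro borel_measurable_times_ennreal borel_measurable_indicator) auto
  have W: "emeasure lborel (cball (0::'a) (B + 1)) = ennreal W"
    using emeasure_bounded_finite[OF bounded_cball, of "0::'a" "B + 1"]
    unfolding W_def by (intro emeasure_eq_ennreal_measure) simp
  have W0: "0 \<le> W" by (simp add: W_def)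
  have "0 < e * M" using K by (simp add: M_def)
  then have M: "0 < M" using e by (simp add: zero_less_mult_iff)
  \<comment> \<open>The uniform error \<eta> on a ball of measure \<open>W\<close> must use up less
    than the gap \<open>e * M - 4 * K\<close>. The denominator exceeds \<open>W\<close> and is
    positive.\<close>
  define \<eta> where "\<eta> = (e * M - 4 * K) / (2 * (W + 1))"
  have "0 < \<eta>" using K W0 by (simp add: \<eta>_def M_def)
  have "\<eta> * W < \<eta> * (2 * (W + 1))" using \<open>0 < \<eta>\<close> W0 by (intro mult_strict_left_mono) auto
  also have "\<dots> = e * M - 4 * K" using W0 by (simp add: \<eta>_def)
  finally have \<eta>W: "\<eta> * W < e * M - 4 * K" .
  obtain r where r: "strict_mono (r :: nat \<Rightarrow> nat)" and conv: "\<And>e. 0 < e \<Longrightarrow> \<exists>N. \<forall>i\<ge>N. \<forall>j\<ge>N. \<forall>x.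
       \<bar>g (r i) x - g (r j) x\<bar> \<le> e * indicat_real (cball 0 (B + 1)) x"
  proof (rule mollified_indicator_subseq[where E = E and \<phi> = \<phi> and B = B, OF cont nonneg sym supp E sub])
    fix r :: "nat \<Rightarrow> nat"
    assume "strict_mono r" and *: "\<And>e. 0 < e \<Longrightarrow> \<exists>N. \<forall>i\<ge>N. \<forall>j\<ge>N. \<forall>x.
       \<bar>(LINT y|lborel. \<phi> (x - y) * indicat_real (E (r i)) y) - (LINT y|lborel. \<phi> (x - y) * indicat_real (E (r j)) y)\<bar>
         \<le> e * indicat_real (cball 0 (B + 1)) x"
    then show thesis
      using that[of r] unfolding g_def by simp
  qed
  from conv[OF \<open>0 < \<eta>\<close>] obtain N1 where N1: "\<And>i j x. i \<ge> N1 \<Longrightarrow> j \<ge> N1 \<Longrightarrow>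
       \<bar>g (r i) x - g (r j) x\<bar> \<le> \<eta> * indicat_real (cball 0 (B + 1)) x"
    by auto
  obtain N2 where N2: "\<And>n. n \<ge> N2 \<Longrightarrow> (\<integral>\<^sup>+x\<in>E n. (\<integral>\<^sup>+y\<in>- E n. ennreal (\<phi> (x - y)) \<partial>lborel) \<partial>lborel) \<le> ennreal K"
    using energy by (auto simp: eventually_sequentially)
  have close: "(\<integral>\<^sup>+x. ennreal \<bar>M * indicat_real (E (r i)) x - g (r i) x\<bar> \<partial>lborel) \<le> ennreal (2 * K)" if "i \<ge> N2" for i
    using L1_distance_mollified_indicator_le[OF int nonneg sym E N2, of "r i"] that seq_suble[OF r, of i] K(1)
    by (simp add: M_def g_def ennreal_mult)
  have iE: "integrable lborel (indicat_real (E n))" for n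
    using emeasure_bounded_finite[OF bounded_subset[OF bounded_ball sub]] by (simp add: integrable_indicator_iff)
  show ?thesis
  proof (rule that[OF r, of "max N1 N2"])
    fix i j assume ij: "i \<ge> max N1 N2" "j \<ge> max N1 N2"
    let ?f = "\<lambda>k. indicat_real (E (r k))"
    have "ennreal (M * (LINT x|lborel. \<bar>?f i x - ?f j x\<bar>)) = (\<integral>\<^sup>+x. ennreal (M * \<bar>?f i x - ?f j x\<bar>) \<partial>lborel)"
      using M iE by (subst nn_integral_eq_integral) auto
    also have "\<dots> \<le> (\<integral>\<^sup>+x. ennreal \<bar>M * ?f i x - g (r i) x\<bar> + ennreal \<bar>M * ?f j x - g (r j) x\<bar>
        + ennreal \<eta> * indicator (cball 0 (B + 1)) x \<partial>lborel)"
    proof (intro nn_integral_mono)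
      fix x
      have "M * \<bar>?f i x - ?f j x\<bar> = \<bar>M * ?f i x - M * ?f j x\<bar>"
        using M by (simp add: abs_mult right_diff_distrib[symmetric])
      also have "\<dots> \<le> \<bar>M * ?f i x - g (r i) x\<bar> + \<bar>M * ?f j x - g (r j) x\<bar> + \<eta> * indicat_real (cball 0 (B + 1)) x"
        using N1[of i j x] ij by linarith
      finally have "ennreal (M * \<bar>?f i x - ?f j x\<bar>) \<le> ennreal (\<bar>M * ?f i x - g (r i) x\<bar>
          + \<bar>M * ?f j x - g (r j) x\<bar> + \<eta> * indicat_real (cball 0 (B + 1)) x)"
        by (rule ennreal_leI)
      also have "\<dots> = ennreal \<bar>M * ?f i x - g (r i) x\<bar> + ennreal \<bar>M * ?f j x - g (r j) x\<bar>
          + ennreal \<eta> * indicator (cball 0 (B + 1)) x"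
        using \<open>0 < \<eta>\<close> by (auto simp: indicator_def)
      finally show "ennreal (M * \<bar>?f i x - ?f j x\<bar>) \<le> \<dots>" .
    qed
    also have "\<dots> = (\<integral>\<^sup>+x. ennreal \<bar>M * ?f i x - g (r i) x\<bar> \<partial>lborel) + (\<integral>\<^sup>+x. ennreal \<bar>M * ?f j x - g (r j) x\<bar> \<partial>lborel)
        + ennreal \<eta> * emeasure lborel (cball (0::'a) (B + 1))"
      by (simp add: nn_integral_add nn_integral_cmult_indicator)
    also have "\<dots> \<le> ennreal (2 * K) + ennreal (2 * K) + ennreal \<eta> * ennreal W"
      using close[of i] close[of j] ij unfolding W by (intro add_mono order_refl) simp_all
    also have "\<dots> = ennreal (4 * K + \<eta> * W)"
      using K(1) W0 \<open>0 < \<eta>\<close> by (simp add: ennreal_mult[symmetric] ennreal_plus[symmetric] del: ennreal_plus)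
    finally have "M * (LINT x|lborel. \<bar>?f i x - ?f j x\<bar>) \<le> 4 * K + \<eta> * W"
      using K(1) W0 \<open>0 < \<eta>\<close> by (subst (asm) ennreal_le_iff) auto
    with \<eta>W have "M * (LINT x|lborel. \<bar>?f i x - ?f j x\<bar>) < M * e"
      by (simp add: mult.commute)
    then show "(LINT x|lborel. \<bar>?f i x - ?f j x\<bar>) < e"
      using M by simp
  qed
qed

text \<open>The energy bound \<open>K\<close> stays fixed while the mass of the kernel may be as
  large as desired. At stage \<open>k\<close> a kernel of mass above \<open>4 * K * Suc k\<close>
  gives a subsequence whose members are eventually within \<open>1 / Suc k\<close> of each other,
  and a diagonal sequence serves all tolerances at once.\<close>

lemma L1_Cauchy_indicator_subseq:
  fixes E :: "nat \<Rightarrow> 'a::euclidean_space set"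
  assumes E: "\<And>n. E n \<in> sets borel" and sub: "\<And>n. E n \<subseteq> ball 0 B" and K: "0 \<le> K"
    and kernels: "\<And>L. \<exists>\<phi>. continuous_on UNIV \<phi> \<and> (\<forall>x. 0 \<le> \<phi> x) \<and> (\<forall>x. \<phi> (- x) = \<phi> x) \<and>
      (\<forall>x. 1 \<le> norm x \<longrightarrow> \<phi> x = 0) \<and> L < (LINT x|lborel. \<phi> x) \<and>
      (\<forall>\<^sub>F n in sequentially. (\<integral>\<^sup>+x\<in>E n. (\<integral>\<^sup>+y\<in>- E n. ennreal (\<phi> (x - y)) \<partial>lborel) \<partial>lborel) \<le> ennreal K)"
  obtains r :: "nat \<Rightarrow> nat" where "strict_mono r"
    "\<And>e. 0 < e \<Longrightarrow> \<exists>N. \<forall>i\<ge>N. \<forall>j\<ge>N. (LINT x|lborel. \<bar>indicat_real (E (r i)) x - indicat_real (E (r j)) x\<bar>) < e"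
proof -
  define P where "P = (\<lambda>k (s :: nat \<Rightarrow> nat). \<exists>N. \<forall>i\<ge>N. \<forall>j\<ge>N.
    (LINT x|lborel. \<bar>indicat_real (E (s i)) x - indicat_real (E (s j)) x\<bar>) < 1 / real (Suc k))"
  interpret subseqs P
  proof
    fix k and s :: "nat \<Rightarrow> nat" assume s: "strict_mono s"
    obtain \<phi> where \<phi>: "continuous_on UNIV \<phi>" "\<And>x. 0 \<le> \<phi> x" "\<And>x. \<phi> (- x) = \<phi> x"
      "\<And>x. 1 \<le> norm x \<Longrightarrow> \<phi> x = 0" "real (Suc k) * (4 * K) < (LINT x|lborel. \<phi> x)"
      and ev: "\<forall>\<^sub>F n in sequentially. (\<integral>\<^sup>+x\<in>E n. (\<integral>\<^sup>+y\<in>- E n. ennreal (\<phi> (x - y)) \<partial>lborel) \<partial>lborel) \<le> ennreal K"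
      using kernels[of "real (Suc k) * (4 * K)"] by blast
    have "4 * K < 1 / real (Suc k) * (LINT x|lborel. \<phi> x)"
      using \<phi>(5) by (simp add: field_simps del: of_nat_Suc)
    moreover have "\<forall>\<^sub>F n in sequentially. (\<integral>\<^sup>+x\<in>E (s n). (\<integral>\<^sup>+y\<in>- E (s n). ennreal (\<phi> (x - y)) \<partial>lborel) \<partial>lborel) \<le> ennreal K"
      by (rule eventually_subseq[OF s ev])
    ultimately obtain r N where "strict_mono (r :: nat \<Rightarrow> nat)" "\<And>i j. i \<ge> N \<Longrightarrow> j \<ge> N \<Longrightarrow>
        (LINT x|lborel. \<bar>indicat_real (E (s (r i))) x - indicat_real (E (s (r j))) x\<bar>) < 1 / real (Suc k)"
      using L1_totally_bounded_indicator_subseq[OF \<phi>(1-4), where E = "\<lambda>n. E (s n)" and B = B and K = K and e = "1 / real (Suc k)"] E sub K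
      by (auto simp del: of_nat_Suc)
    then have "P k (s \<circ> r)"
      unfolding P_def o_def by blast
    with \<open>strict_mono r\<close> show "\<exists>r. strict_mono r \<and> P k (s \<circ> r)"
      by blast
  qed
  show ?thesis
  proof (rule that[OF subseq_diagseq])
    fix e :: real assume "0 < e"
    then obtain k where k: "1 / real (Suc k) < e"
      using nat_approx_posE by blast
    \<comment> \<open>Only the tail of the diagonal sequence from index \<open>Suc k\<close> on is a
      subsequence of the one extracted at stage \<open>k\<close>; hence the shift, and the threshold
      \<open>Suc k + N\<close> below.\<close>
    have "P k (diagseq \<circ> (+) (Suc k))"
    proof (rule diagseq_holds)
      fix r s :: "nat \<Rightarrow> nat" and n assume r: "strict_mono r" and "P n s"
      then obtain N where "\<forall>i\<ge>N. \<forall>j\<ge>N.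
          (LINT x|lborel. \<bar>indicat_real (E (s i)) x - indicat_real (E (s j)) x\<bar>) < 1 / real (Suc n)"
        unfolding P_def by blast
      \<comment> \<open>Since \<open>r i\<close> is at least \<open>i\<close>, the threshold
        \<open>N\<close> of \<open>s\<close> also works for \<open>s \<circ> r\<close>.\<close>
      then show "P n (s \<circ> r)"
        unfolding P_def o_def using order_trans[OF _ seq_suble[OF r]] by meson
    qed
    then obtain N where N: "\<And>i j. i \<ge> N \<Longrightarrow> j \<ge> N \<Longrightarrow> (LINT x|lborel. \<bar>indicat_real (E (diagseq (Suc k + i))) x
        - indicat_real (E (diagseq (Suc k + j))) x\<bar>) < 1 / real (Suc k)"
      unfolding P_def o_def by blast
    have "(LINT x|lborel. \<bar>indicat_real (E (diagseq i)) x - indicat_real (E (diagseq j)) x\<bar>) < e"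
      if "i \<ge> Suc k + N" "j \<ge> Suc k + N" for i j
      using N[of "i - Suc k" "j - Suc k"] that k by fastforce
    then show "\<exists>N. \<forall>i\<ge>N. \<forall>j\<ge>N.
        (LINT x|lborel. \<bar>indicat_real (E (diagseq i)) x - indicat_real (E (diagseq j)) x\<bar>) < e"
      by blast
  qed
qed

section \<open>Truncated kernels of large mass\<close>

text \<open>Subtracting 1 makes the truncated kernel vanish continuously at \<open>norm x = 1\<close>.\<close>

definition trunc_kernel :: "real \<Rightarrow> 'a::euclidean_space \<Rightarrow> real" where
  "trunc_kernel \<delta> x = max 0 (max (norm x) \<delta> powr (- real DIM('a)) - 1)"

lemma continuous_on_trunc_kernel: "0 < \<delta> \<Longrightarrow> continuous_on S (trunc_kernel \<delta>)"
  unfolding trunc_kernel_def by (intro continuous_intros) auto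

lemma trunc_kernel_nonneg: "0 \<le> trunc_kernel \<delta> x"
  by (simp add: trunc_kernel_def)

lemma trunc_kernel_minus: "trunc_kernel \<delta> (- x) = trunc_kernel \<delta> x"
  by (simp add: trunc_kernel_def)

lemma trunc_kernel_eq_0:
  assumes "1 \<le> norm x"
  shows "trunc_kernel \<delta> (x::'a::euclidean_space) = 0"
  using powr_mono2'[of "- real DIM('a)" 1 "max (norm x) \<delta>"] assms by (simp add: trunc_kernel_def)

text \<open>With \<open>m\<close> the maximum of \<open>norm x\<close> and \<delta>, the two powers
  of \<open>m\<close> differ by the factor \<open>m powr (- \<sigma>)\<close>. This is at least 1 if
  \<sigma> is nonnegative, and otherwise it increases with \<open>m\<close>, so the assumed bound
  1/2 at \<delta> carries over to \<open>m\<close>. Replacing \<open>m\<close> by the smaller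
  \<open>norm x\<close> only enlarges the right-hand side.\<close>

lemma trunc_kernel_le:
  fixes x :: "'a::euclidean_space"
  assumes "0 < \<delta>" "\<delta> < 1" "0 < real DIM('a) + \<sigma>" "1 / 2 \<le> \<delta> powr (- \<sigma>)" "x \<noteq> 0" "norm x < 1"
  shows "trunc_kernel \<delta> x \<le> 2 * (1 / norm x powr (real DIM('a) + \<sigma>))"
proof -
  define m where "m = max (norm x) \<delta>"
  have m: "0 < m" "m < 1" "\<delta> \<le> m" "norm x \<le> m"
    using assms by (auto simp: m_def)
  have "1 / 2 \<le> m powr (- \<sigma>)"
  proof (cases "0 \<le> \<sigma>")
    case True
    then show ?thesis using powr_mono2'[of "- \<sigma>" m 1] m by simp
  next
    case False
    then show ?thesis using powr_mono2[of "- \<sigma>" \<delta> m] m assms by simp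
  qed
  then have "m powr (- real DIM('a)) * (1 / 2) \<le> m powr (- real DIM('a)) * m powr (- \<sigma>)"
    by (intro mult_left_mono) auto
  also have "\<dots> = m powr (- (real DIM('a) + \<sigma>))"
    by (simp add: powr_add[symmetric])
  also have "\<dots> \<le> norm x powr (- (real DIM('a) + \<sigma>))"
    using m assms by (intro powr_mono2') auto
  also have "\<dots> = 1 / norm x powr (real DIM('a) + \<sigma>)"
    by (rule powr_minus_divide)
  finally show ?thesis
    using assms by (simp add: trunc_kernel_def m_def[symmetric])
qed

text \<open>On the annulus between \<delta> and 1 the truncated kernel plus 1 dominates
  \<open>norm x\<close> to the power -d, with d the dimension, and the annulus formula with \<sigma>
  = 0 evaluates the integral of the latter to the logarithmic term. The added 1 costs one volume of
  the unit ball. The bound diverges as \<delta> tends to 0.\<close>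

lemma integral_trunc_kernel_ge:
  assumes \<delta>: "0 < \<delta>" "\<delta> < 1"
  shows "unit_ball_vol DIM('a) * (real DIM('a) * (- ln \<delta>) - 1) \<le> (LINT x|lborel. trunc_kernel \<delta> (x::'a::euclidean_space))"
proof -
  let ?c = "unit_ball_vol (real DIM('a))" and ?k = "trunc_kernel \<delta> :: 'a \<Rightarrow> real"
  have int: "integrable lborel ?k"
    by (rule integrable_continuous_unit_support[OF continuous_on_trunc_kernel[OF \<delta>(1)] trunc_kernel_eq_0])
  have I0: "0 \<le> (LINT x|lborel. ?k x)"
    by (intro Bochner_Integration.integral_nonneg trunc_kernel_nonneg)
  have "ennreal (real DIM('a) * ?c * (- ln \<delta>))
      = (\<integral>\<^sup>+x\<in>ball 0 1 - ball (0::'a) \<delta>. ennreal (1 / norm x powr (real DIM('a))) \<partial>lborel)"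
    using nn_integral_annulus[where 'a = 'a, of \<delta> 1 0] \<delta> by (simp add: gamma_coeff_def)
  also have "\<dots> \<le> (\<integral>\<^sup>+x. ennreal (?k x) + indicator (ball (0::'a) 1) x \<partial>lborel)"
  proof (intro nn_integral_mono)
    fix x :: 'a
    show "ennreal (1 / norm x powr (real DIM('a))) * indicator (ball 0 1 - ball 0 \<delta>) x \<le> ennreal (?k x) + indicator (ball 0 1) x"
    proof (cases "x \<in> ball 0 1 - ball 0 \<delta>")
      case True
      then have "1 / norm x powr (real DIM('a)) \<le> ?k x + 1"
        using \<delta> by (simp add: trunc_kernel_def powr_minus_divide)
      then have "ennreal (1 / norm x powr (real DIM('a))) \<le> ennreal (?k x + 1)"
        by (rule ennreal_leI)
      then show ?thesis
        using True trunc_kernel_nonneg[of \<delta> x] by (simp add: indicator_def)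
    qed auto
  qed
  also have "\<dots> = ennreal (LINT x|lborel. ?k x) + ennreal ?c"
    using int by (subst nn_integral_add)
      (auto simp: nn_integral_eq_integral trunc_kernel_nonneg emeasure_ball borel_measurable_integrable
        intro!: borel_measurable_indicator)
  finally have "real DIM('a) * ?c * (- ln \<delta>) \<le> (LINT x|lborel. ?k x) + ?c"
    using I0 by (simp add: ennreal_plus[symmetric] ennreal_le_iff del: ennreal_plus)
  then show ?thesis
    by (simp add: algebra_simps)
qed

section \<open>Compactness for bounded energies\<close>

text \<open>Common form of both parts of the theorem. The assumption \<open>low\<close> is the only
  link between the exponents and the truncated kernel: \<delta> is fixed first, according to the
  mass wanted, and the comparison of kernels then holds for all large \<open>n\<close>.\<close>

lemma H_hat_compactness:
  fixes \<sigma> R :: "nat \<Rightarrow> real" and E :: "nat \<Rightarrow> (real ^ 'n) set"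
  assumes \<sigma>: "\<And>n. 0 < real CARD('n) + \<sigma> n" and R: "\<And>n. 0 < R n"
    and U: "bounded U" and E: "\<And>n. E n \<in> lmeasurable" "\<And>n. E n \<subseteq> U" and C: "0 \<le> C"
    and H: "\<And>n. H_hat (\<sigma> n) (R n) (E n) \<le> ereal C"
    and low: "\<And>\<delta>. 0 < \<delta> \<Longrightarrow> \<delta> < 1 \<Longrightarrow> \<forall>\<^sub>F n in sequentially. 1 / 2 \<le> \<delta> powr (- \<sigma> n)"
  shows "\<exists>F \<in> lmeasurable. \<exists>r :: nat \<Rightarrow> nat. strict_mono r \<and>
      (\<lambda>k. LINT x|lebesgue. \<bar>indicat_real (E (r k)) x - indicat_real F x\<bar>) \<longlonglongrightarrow> 0"
proof -
  obtain B where B: "U \<subseteq> ball 0 B"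
    using bounded_subset_ballD[OF U, of 0] by auto
  \<comment> \<open>A Borel subset of \<open>E n\<close> with null complement in it, so that the
    results over \<open>lborel\<close> apply and the inclusion in \<open>ball 0 B\<close> is
    kept.\<close>
  define A where "A n = main_part lborel (E n)" for n
  have leb: "E n \<in> sets lebesgue" for n
    using E(1) by auto
  have A[measurable]: "A n \<in> sets borel" for n
    using main_part_sets[OF leb[of n]] by (simp add: A_def)
  have AE: "AE x in lborel. x \<in> E n \<longleftrightarrow> x \<in> A n" for n
    using AE_in_main_part[OF leb[of n]] by (auto simp: A_def)
  have AB: "A n \<subseteq> ball 0 B" for n
    using main_part_null_part_Un[OF leb[of n]] E(2)[of n] B by (auto simp: A_def)
  define V where "V = measure lborel (ball (0::real ^ 'n) B)"
  have fin: "emeasure lborel (A n) < \<infinity>" for n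
    using emeasure_bounded_finite[OF bounded_subset[OF bounded_ball AB]] .
  have mV: "measure lborel (A n) \<le> V" for n
    unfolding V_def using AB emeasure_bounded_finite[OF bounded_ball, of "0 :: real ^ 'n" B]
    by (intro measure_mono_fmeasurable) (auto simp: fmeasurable_def)
  \<comment> \<open>The boundedness of \<open>U\<close> enters here: it replaces the measure of
    \<open>A n\<close> by \<open>V\<close> and makes the bound uniform in \<open>n\<close>.\<close>
  have energy: "(\<integral>\<^sup>+x\<in>A n. (\<integral>\<^sup>+y\<in>ball x 1 - A n. ennreal (1 / norm (x - y) powr (real CARD('n) + \<sigma> n)) \<partial>lborel) \<partial>lborel)
      \<le> ennreal (C + V\<^sup>2)" for n
  proof -
    have "H_hat (\<sigma> n) (R n) (A n) = H_hat (\<sigma> n) (R n) (E n)"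
      using AE[of n] leb[of n] by (intro H_hat_cong_AE AE_completion) (auto elim: eventually_mono)
    then have "(\<integral>\<^sup>+x\<in>A n. (\<integral>\<^sup>+y\<in>ball x 1 - A n. ennreal (1 / norm (x - y) powr (real CARD('n) + \<sigma> n)) \<partial>lborel) \<partial>lborel)
        \<le> ennreal (C + (measure lborel (A n))\<^sup>2)"
      using H[of n] by (intro unit_scale_energy_le[OF A fin R[of n] \<sigma>]) simp
    also have "\<dots> \<le> ennreal (C + V\<^sup>2)"
      using mV by (intro ennreal_leI add_left_mono power_mono) auto
    finally show ?thesis .
  qed
  \<comment> \<open>The factor 2 comes from \<open>trunc_kernel_le\<close>. It is essential that
    \<open>K\<close> depends neither on \<open>n\<close> nor on \<delta>.\<close>
  define K where "K = 2 * (C + V\<^sup>2)"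
  have K: "0 \<le> K" using C by (simp add: K_def)
  have kernels: "\<exists>\<phi>. continuous_on UNIV \<phi> \<and> (\<forall>x. 0 \<le> \<phi> x) \<and> (\<forall>x. \<phi> (- x) = \<phi> x) \<and>
      (\<forall>x. 1 \<le> norm x \<longrightarrow> \<phi> x = 0) \<and> L < (LINT x|lborel. \<phi> x) \<and>
      (\<forall>\<^sub>F n in sequentially. (\<integral>\<^sup>+x\<in>A n. (\<integral>\<^sup>+y\<in>- A n. ennreal (\<phi> (x - y)) \<partial>lborel) \<partial>lborel) \<le> ennreal K)" for L
  proof -
    let ?c = "unit_ball_vol (real CARD('n))"
    \<comment> \<open>With \<open>\<delta> = exp (- t)\<close> the lower bound for the mass is
      \<open>?c * (CARD('n) * t - 1)\<close>. As the dimension is at least 1, this is at least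
      \<open>?c * (t - 1)\<close>, which equals \<open>\<bar>L\<bar> + ?c\<close> and exceeds
      \<open>L\<close>.\<close>
    define t where "t = \<bar>L\<bar> / ?c + 2"
    define \<delta> where "\<delta> = exp (- t)"
    have c: "0 < ?c" by simp
    then have t: "0 < t" by (simp add: t_def add_nonneg_pos)
    then have \<delta>: "0 < \<delta>" "\<delta> < 1" by (auto simp: \<delta>_def)
    have "L < ?c * (t - 1)"
    proof -
      have "?c \<noteq> 0" using c by linarith
      then have "?c * (t - 1) = \<bar>L\<bar> + ?c" by (simp add: t_def field_simps)
      then show ?thesis using c by linarith
    qed
    also have "\<dots> \<le> ?c * (real CARD('n) * t - 1)"
      using t c by (intro mult_left_mono diff_right_mono) auto
    also have "\<dots> \<le> (LINT x|lborel. trunc_kernel \<delta> (x :: real ^ 'n))"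
      using integral_trunc_kernel_ge[where 'a = "real ^ 'n", OF \<delta>] by (simp add: \<delta>_def)
    finally have L: "L < (LINT x|lborel. trunc_kernel \<delta> (x :: real ^ 'n))" .
    have "\<forall>\<^sub>F n in sequentially. (\<integral>\<^sup>+x\<in>A n. (\<integral>\<^sup>+y\<in>- A n. ennreal (trunc_kernel \<delta> (x - y)) \<partial>lborel) \<partial>lborel) \<le> ennreal K"
      using low[OF \<delta>]
    proof eventually_elim
      case (elim n)
      let ?k = "\<lambda>x y. ennreal (1 / norm (x - y) powr (real CARD('n) + \<sigma> n))"
      have "(\<integral>\<^sup>+x\<in>A n. (\<integral>\<^sup>+y\<in>- A n. ennreal (trunc_kernel \<delta> (x - y)) \<partial>lborel) \<partial>lborel)
          \<le> (\<integral>\<^sup>+x. 2 * ((\<integral>\<^sup>+y\<in>ball x 1 - A n. ?k x y \<partial>lborel) * indicator (A n) x) \<partial>lborel)"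
      proof (intro nn_integral_mono)
        fix x :: "real ^ 'n"
        show "(\<integral>\<^sup>+y\<in>- A n. ennreal (trunc_kernel \<delta> (x - y)) \<partial>lborel) * indicator (A n) x
          \<le> 2 * ((\<integral>\<^sup>+y\<in>ball x 1 - A n. ?k x y \<partial>lborel) * indicator (A n) x)"
        proof (cases "x \<in> A n")
          case True
          have "(\<integral>\<^sup>+y\<in>- A n. ennreal (trunc_kernel \<delta> (x - y)) \<partial>lborel)
              \<le> (\<integral>\<^sup>+y. 2 * (?k x y * indicator (ball x 1 - A n) y) \<partial>lborel)"
          proof (intro nn_integral_mono)
            fix y
            show "ennreal (trunc_kernel \<delta> (x - y)) * indicator (- A n) y
              \<le> 2 * (?k x y * indicator (ball x 1 - A n) y)"
            proof (cases "y \<notin> A n \<and> norm (x - y) < 1")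
              case y: True
              \<comment> \<open>Since \<open>x\<close> lies in \<open>A n\<close> and
                \<open>y\<close> does not, \<open>x - y\<close> is nonzero. At 0 the estimate would
                fail: division by zero makes the singular kernel 0 there, while the truncated one is
                positive.\<close>
              then have "trunc_kernel \<delta> (x - y) \<le> 2 * (1 / norm (x - y) powr (real CARD('n) + \<sigma> n))"
                using trunc_kernel_le[OF \<delta>, of "\<sigma> n" "x - y"] \<sigma>[of n] elim True by auto
              then have "ennreal (trunc_kernel \<delta> (x - y)) \<le> 2 * ?k x y"
                by (subst ennreal_numeral[symmetric], subst ennreal_mult[symmetric]) (auto intro: ennreal_leI)
              then show ?thesis
                using y by (simp add: indicator_def dist_norm)
            next
              case False
              then show ?thesis
                using trunc_kernel_eq_0[of "x - y" \<delta>] by (auto simp: indicator_def)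
            qed
          qed
          also have "\<dots> = 2 * (\<integral>\<^sup>+y\<in>ball x 1 - A n. ?k x y \<partial>lborel)"
            by (intro nn_integral_cmult borel_measurable_times_ennreal borel_measurable_indicator) auto
          finally show ?thesis using True by simp
        qed simp
      qed
      also have "\<dots> = 2 * (\<integral>\<^sup>+x\<in>A n. (\<integral>\<^sup>+y\<in>ball x 1 - A n. ?k x y \<partial>lborel) \<partial>lborel)"
      proof (rule nn_integral_cmult)
        have [measurable]: "(\<lambda>(x, y). indicator (ball x 1 - A n) y :: ennreal) \<in> borel_measurable (lborel \<Otimes>\<^sub>M lborel)"
          unfolding indicator_def ball_def by measurable
        show "(\<lambda>x. (\<integral>\<^sup>+y\<in>ball x 1 - A n. ?k x y \<partial>lborel) * indicator (A n) x) \<in> borel_measurable lborel"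
          by measurable
      qed
      also have "\<dots> \<le> 2 * ennreal (C + V\<^sup>2)"
        by (intro mult_left_mono energy) auto
      also have "\<dots> = ennreal K"
        using C by (simp add: K_def ennreal_mult)
      finally show ?case .
    qed
    then show ?thesis
      using continuous_on_trunc_kernel[OF \<delta>(1)] trunc_kernel_nonneg trunc_kernel_minus trunc_kernel_eq_0 L
      by (intro exI[of _ "trunc_kernel \<delta>"]) auto
  qed
  obtain s :: "nat \<Rightarrow> nat" where s: "strict_mono s" and Cau: "\<And>e. 0 < e \<Longrightarrow> \<exists>N. \<forall>i\<ge>N. \<forall>j\<ge>N.
      (LINT x|lborel. \<bar>indicat_real (A (s i)) x - indicat_real (A (s j)) x\<bar>) < e"
    using L1_Cauchy_indicator_subseq[where E = A, OF A AB K kernels] by blast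
  obtain F and r :: "nat \<Rightarrow> nat" where F: "F \<in> sets lborel" "F \<subseteq> ball 0 B" and r: "strict_mono r"
    and lim: "(\<lambda>k. LINT x|lborel. \<bar>indicat_real (A (s (r k))) x - indicat_real F x\<bar>) \<longlonglongrightarrow> 0"
  proof (rule Cauchy_imp_convergent_indicator_subseq[where A = "\<lambda>n. A (s n)" and M = lborel and U = "ball (0::real ^ 'n) B"])
    show "ball (0::real ^ 'n) B \<in> fmeasurable lborel"
      using emeasure_bounded_finite[OF bounded_ball, of "0 :: real ^ 'n" B] by (auto simp: fmeasurable_def)
  qed (use A AB Cau in auto)
  have [measurable]: "F \<in> sets borel" using F by simp
  \<comment> \<open>Return from the Borel sets \<open>A n\<close> over \<open>lborel\<close> to the
    original sets over \<open>lebesgue\<close>.\<close>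
  have eq: "(LINT x|lebesgue. \<bar>indicat_real (E n) x - indicat_real F x\<bar>) = (LINT x|lborel. \<bar>indicat_real (A n) x - indicat_real F x\<bar>)" for n
  proof -
    have "(LINT x|lebesgue. \<bar>indicat_real (E n) x - indicat_real F x\<bar>) = (LINT x|lebesgue. \<bar>indicat_real (A n) x - indicat_real F x\<bar>)"
    proof (rule integral_cong_AE)
      have [measurable]: "E n \<in> sets lebesgue" "A n \<in> sets lebesgue" "F \<in> sets lebesgue"
        using leb A F(1) by auto
      show "(\<lambda>x. \<bar>indicat_real (E n) x - indicat_real F x\<bar>) \<in> borel_measurable lebesgue"
        "(\<lambda>x. \<bar>indicat_real (A n) x - indicat_real F x\<bar>) \<in> borel_measurable lebesgue"
        by measurable
      show "AE x in lebesgue. \<bar>indicat_real (E n) x - indicat_real F x\<bar> = \<bar>indicat_real (A n) x - indicat_real F x\<bar>"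
        using AE_completion[OF AE[of n]] by eventually_elim (simp add: indicator_def)
    qed
    also have "\<dots> = (LINT x|lborel. \<bar>indicat_real (A n) x - indicat_real F x\<bar>)"
      by (rule integral_completion) measurable
    finally show ?thesis .
  qed
  have "F \<in> lmeasurable"
    using F by (intro bounded_set_imp_lmeasurable bounded_subset[OF bounded_ball F(2)]) auto
  moreover have "(\<lambda>k. LINT x|lebesgue. \<bar>indicat_real (E ((s \<circ> r) k)) x - indicat_real F x\<bar>) \<longlonglongrightarrow> 0"
    using lim by (simp add: eq)
  ultimately show ?thesis
    using strict_mono_o[OF s r] by blast
qed

theorem theorem5p4:
  fixes \<sigma> R :: "nat \<Rightarrow> real"
    and U :: "(real ^ 'n) set"
    and E :: "nat \<Rightarrow> (real ^ 'n) set"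
    and C :: real
  assumes "\<And>n. \<sigma> n \<in> {- real CARD('n)<..<1}"
    and "\<And>n. R n > 0"
    and "open U" and "bounded U"
    and "\<And>n. E n \<in> lmeasurable"
    and "\<And>n. E n \<subseteq> U"
    and "C > 0"
    and "\<And>n. H_hat (\<sigma> n) (R n) (E n) \<le> ereal C"
  shows "((\<forall>n. \<sigma> n \<in> {0..<1}) \<longrightarrow>
           (\<exists>F \<in> lmeasurable. \<exists>r :: nat \<Rightarrow> nat. strict_mono r \<and>
             (\<lambda>k. LINT x|lebesgue. \<bar>indicat_real (E (r k)) x - indicat_real F x\<bar>)
               \<longlonglongrightarrow> 0))
       \<and> (\<sigma> \<longlonglongrightarrow> 0 \<longrightarrow>
           (\<exists>F \<in> lmeasurable. \<exists>r :: nat \<Rightarrow> nat. strict_mono r \<and>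
             (\<lambda>k. LINT x|lebesgue. \<bar>indicat_real (E (r k)) x - indicat_real F x\<bar>)
               \<longlonglongrightarrow> 0))"
proof -
  have \<sigma>: "0 < real CARD('n) + \<sigma> n" for n
    using assms(1)[of n] by auto
  note compactness = H_hat_compactness[OF \<sigma> assms(2,4,5,6) less_imp_le[OF assms(7)] assms(8)]
  show ?thesis
  \<comment> \<open>What remains in both parts is the lower bound on
    \<open>\<delta> powr (- \<sigma> n)\<close>. For nonnegative exponents it is at least 1 because
    \<delta> is below 1; if the exponents tend to 0, it tends to 1 and is eventually above
    1/2.\<close>
  proof (intro conjI impI; rule compactness)
    fix \<delta> :: real assume \<delta>: "0 < \<delta>" "\<delta> < 1"
    {
      assume "\<forall>n. \<sigma> n \<in> {0..<1}"
      then have "1 \<le> \<delta> powr (- \<sigma> n)" for n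
        using powr_mono2'[of "- \<sigma> n" \<delta> 1] \<delta> by simp
      then have "1 / 2 \<le> \<delta> powr (- \<sigma> n)" for n
        using order_trans[of "1 / 2" 1 "\<delta> powr (- \<sigma> n)"] by simp
      then show "\<forall>\<^sub>F n in sequentially. 1 / 2 \<le> \<delta> powr (- \<sigma> n)"
        by simp
    next
      assume "\<sigma> \<longlonglongrightarrow> 0"
      then have "(\<lambda>n. \<delta> powr (- \<sigma> n)) \<longlonglongrightarrow> \<delta> powr (- 0)"
        using \<delta> by (intro tendsto_intros) auto
      then have "\<forall>\<^sub>F n in sequentially. 1 / 2 < \<delta> powr (- \<sigma> n)"
        using \<delta> by (intro order_tendstoD) auto
      then show "\<forall>\<^sub>F n in sequentially. 1 / 2 \<le> \<delta> powr (- \<sigma> n)"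
        by (rule eventually_mono) simp
    }
  qed
qed

end
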